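(* Assume that the real-valued function $f\in L^2(\mathbb{R}^3)$ with support $D$ satisfies either $c_f\le f(y)\le C_f$ for all $y\in D$, or $-C_f\le f(y)\le -c_f$ for all $y\in D$, for two constants $C_f>c_f>0$. For each $x\in\Gamma_L$, let $r_1:=\inf\{|x-y|: y\in D\}$ and $r_2:=\sup\{|x-y|: y\in D\}$. Then $$\frac{c_f}{4\pi r_2}\,\|\mathcal{P}_x^*g\|^2_{L^2(D)}\ \le\ \left|(\mathcal{N}_x g,g)_{L^2(K)}\right|\ \le\ \frac{C_f}{4\pi r_1}\,\|\mathcal{P}_x^*g\|^2_{L^2(D)},\qquad \forall\, g\in L^2(K).$$
   Context: $D\subset\mathbb{R}^3$ is a bounded Lipschitz domain with connected complement $\mathbb{R}^3\setminus\overline{D}$, and it is the support of the real-valued source $f$ (so $f$ vanishes outside $\overline D$). Let $k_{max}>0$ and $K:=(0,k_{max}]$. Let $\Gamma_L=\{x_1,\dots,x_L\}\subset\mathbb{R}^3\setminus\overline{D}$ be a finite set of measurement points. For $k\in K$, $u^s(\cdot,k)$ denotes the unique solution of $\Delta u^s+k^2u^s=f$ in $\mathbb{R}^3$ satisfying the Sommerfeld radiation condition $\lim_{r=|x|\to\infty} r\left(\frac{\partial u^s}{\partial r}-iku^s\right)=0$ uniformly in all directions $x/|x|$. In the paper's sign convention it is given by $$u^s(x,k)=\int_D \frac{e^{ik|x-y|}}{4\pi|x-y|}f(y)\,dy,\quad x\in\mathbb{R}^3,\ k\in K,$$ and this formula is taken as the definition of $u^s(x,k)$. For negative frequencies one sets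 $u^s(x,-k):=\overline{u^s(x,k)}$ for $x\in\Gamma_L$, $k\in K$. For $x\in\Gamma_L$, the multi-frequency near field operator $\mathcal{N}_x: L^2(K)\to L^2(K)$ is $$(\mathcal{N}_x g)(t):=\int_K u^s(x,t-s)\,g(s)\,ds,\quad t\in K$$ (the single value $s=t$, where $u^s(x,0)$ is not specified, is irrelevant to the integral). The operator $\mathcal{P}_x^*: L^2(K)\to L^2(D)$ is $$(\mathcal{P}_x^*\phi)(y):=\int_K e^{-is|x-y|}\phi(s)\,ds,\quad y\in D,$$ which is the adjoint of $\mathcal{P}_x: L^2(D)\to L^2(K)$, $(\mathcal{P}_x\psi)(t):=\int_D e^{it|x-y|}\psi(y)\,dy$. *)

theory Defs
  imports "HOL-Analysis.Analysis"
begin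

text \<open>
  Elements of L2(A) are represented by functions that are Lebesgue measurable and square
  integrable on \<open>A\<close>; functions that agree almost everywhere are not identified, and the
  values of a representative off \<open>A\<close> play no role.
\<close>

definition L2 :: "'a::euclidean_space set \<Rightarrow> ('a \<Rightarrow> 'b::real_normed_vector) set" where
  "L2 A = {u. u \<in> borel_measurable (lebesgue_on A) \<and>
              integrable (lebesgue_on A) (\<lambda>x. (norm (u x))\<^sup>2)}"

definition L2_norm :: "'a::euclidean_space set \<Rightarrow> ('a \<Rightarrow> 'b::real_normed_vector) \<Rightarrow> real" where
  "L2_norm A u = sqrt (\<integral>x. (norm (u x))\<^sup>2 \<partial>lebesgue_on A)"

definition L2_inner :: "'a::euclidean_space set \<Rightarrow> ('a \<Rightarrow> complex) \<Rightarrow> ('a \<Rightarrow> complex) \<Rightarrow> complex" where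
  "L2_inner A u v = (\<integral>x. u x * cnj (v x) \<partial>lebesgue_on A)"

text \<open>
  Near each boundary point, and after an orthogonal change of coordinates, a Lipschitz domain
  is the part of a ball lying strictly above the graph of a Lipschitz function.
\<close>

definition bounded_lipschitz_domain :: "(real ^ 3) set \<Rightarrow> bool" where
  "bounded_lipschitz_domain D \<longleftrightarrow>
     open D \<and> connected D \<and> D \<noteq> {} \<and> bounded D \<and>
     (\<forall>p \<in> frontier D. \<exists>r > 0. \<exists>Q :: real ^ 3 \<Rightarrow> real ^ 3. \<exists>\<gamma> :: real ^ 2 \<Rightarrow> real. \<exists>M.
        orthogonal_transformation Q \<and> M-lipschitz_on UNIV \<gamma> \<and>
        D \<inter> ball p r = {y \<in> ball p r. Q y $ 3 > \<gamma> (vector [Q y $ 1, Q y $ 2])})"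

definition radiated_field :: "(real ^ 3) set \<Rightarrow> (real ^ 3 \<Rightarrow> real) \<Rightarrow> real ^ 3 \<Rightarrow> real \<Rightarrow> complex" where
  "radiated_field D f x k =
     (\<integral>y. exp (\<i> * complex_of_real (k * norm (x - y))) / complex_of_real (4 * pi * norm (x - y))
          * complex_of_real (f y) \<partial>lebesgue_on D)"

text \<open>
  The extension of the field to negative frequencies is by complex conjugation. The value at
  frequency 0 is an arbitrary choice; it enters the near field operator only on the null set
  \<open>s = t\<close>.
\<close>

definition us :: "(real ^ 3) set \<Rightarrow> (real ^ 3 \<Rightarrow> real) \<Rightarrow> real ^ 3 \<Rightarrow> real \<Rightarrow> complex" where
  "us D f x k = (if k < 0 then cnj (radiated_field D f x (- k)) else radiated_field D f x k)"

definition near_field_op ::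
    "(real ^ 3) set \<Rightarrow> (real ^ 3 \<Rightarrow> real) \<Rightarrow> real set \<Rightarrow> real ^ 3 \<Rightarrow> (real \<Rightarrow> complex) \<Rightarrow> real \<Rightarrow> complex" where
  "near_field_op D f K x g t = (\<integral>s. us D f x (t - s) * g s \<partial>lebesgue_on K)"

definition P_adj :: "real set \<Rightarrow> real ^ 3 \<Rightarrow> (real \<Rightarrow> complex) \<Rightarrow> real ^ 3 \<Rightarrow> complex" where
  "P_adj K x \<phi> y = (\<integral>s. exp (- \<i> * complex_of_real (s * norm (x - y))) * \<phi> s \<partial>lebesgue_on K)"

end

theory Submission
  imports Defs
begin

text \<open>
  Put \<open>d y = norm (x - y)\<close> and \<open>w y = f y / (4 * pi * d y)\<close>. Because \<open>f\<close> is real valued, the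
  extension of the field to negative frequencies by conjugation is again the Fourier integral
  over \<open>D\<close> of the form \<open>\<integral>y. exp (\<i> * k * d y) * w y\<close>, so this formula holds at every real \<open>k\<close>. The kernel of the near
  field operator therefore splits into a factor in \<open>t\<close> and a factor in \<open>s\<close>:
  \<open>exp (\<i> * (t - s) * d y) = exp (\<i> * t * d y) * exp (- \<i> * s * d y)\<close>. By Fubini the factor in \<open>s\<close>
  is integrated against \<open>g s\<close>, which gives \<open>P_adj K x g y\<close>, and the factor in \<open>t\<close> against
  \<open>cnj (g t)\<close>, which gives its conjugate. So the quadratic form is diagonal
  (\<open>near_field_quadratic_form\<close>):
  \<open>L2_inner K (near_field_op D f K x g) g = (\<integral>y. w y * (cmod (P_adj K x g y))\<^sup>2)\<close>.

  The source does not change sign, so neither does \<open>w\<close>, and the modulus of this real integral is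
  the integral of \<open>\<bar>w y\<bar> * (cmod (P_adj K x g y))\<^sup>2\<close>. The theorem then follows from the pointwise
  bounds \<open>c_f / (4 * pi * r\<^sub>2) \<le> \<bar>w y\<bar> \<le> C_f / (4 * pi * r\<^sub>1)\<close>. They use \<open>r\<^sub>1 > 0\<close>, that is,
  that \<open>x\<close> lies outside the closure of \<open>D\<close>, and \<open>r\<^sub>2 < \<infinity>\<close>, that is, that \<open>D\<close> is bounded.
\<close>

section \<open>Quadratic forms with a factorized kernel\<close>

text \<open>
  Multiplied by a measurable kernel of modulus at most 1, the tensor product of two integrable
  functions stays integrable on the product space, so Fubini applies.
\<close>

lemma (in pair_sigma_finite) integral_bounded_kernel_swap:
  fixes E :: "'a \<Rightarrow> 'b \<Rightarrow> complex"
  assumes E: "(\<lambda>(s, y). E s y) \<in> borel_measurable (M1 \<Otimes>\<^sub>M M2)"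
    and E_le: "\<And>s y. cmod (E s y) \<le> 1"
    and h: "integrable M1 h" and v: "integrable M2 v"
  shows "(\<integral>s. (\<integral>y. E s y * v y \<partial>M2) * h s \<partial>M1) = (\<integral>y. (\<integral>s. E s y * h s \<partial>M1) * v y \<partial>M2)"
proof -
  have [measurable]: "h \<in> borel_measurable M1" "v \<in> borel_measurable M2"
    using h v by auto
  note E[measurable]
  have hv: "integrable (M1 \<Otimes>\<^sub>M M2) (\<lambda>(s, y). h s * v y)"
  proof (rule Fubini_integrable)
    show "integrable M1 (\<lambda>s. \<integral>y. norm (case (s, y) of (s, y) \<Rightarrow> h s * v y) \<partial>M2)"
      using h by (simp add: norm_mult)
    show "AE s in M1. integrable M2 (\<lambda>y. case (s, y) of (s, y) \<Rightarrow> h s * v y)"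
      using v by simp
  qed measurable
  have int: "integrable (M1 \<Otimes>\<^sub>M M2) (\<lambda>(s, y). E s y * v y * h s)"
  proof (rule Bochner_Integration.integrable_bound[OF hv])
    show "AE p in M1 \<Otimes>\<^sub>M M2. norm (case p of (s, y) \<Rightarrow> E s y * v y * h s)
            \<le> norm (case p of (s, y) \<Rightarrow> h s * v y)"
    proof (intro AE_I2, clarify)
      fix s y
      show "norm (E s y * v y * h s) \<le> norm (h s * v y)"
        using mult_left_le_one_le[of "norm (h s * v y)" "cmod (E s y)"] E_le
        by (simp add: norm_mult mult_ac)
    qed
  qed measurable
  have "(\<integral>s. (\<integral>y. E s y * v y \<partial>M2) * h s \<partial>M1) = (\<integral>s. (\<integral>y. E s y * v y * h s \<partial>M2) \<partial>M1)"
    by simp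
  also have "\<dots> = (\<integral>y. (\<integral>s. E s y * v y * h s \<partial>M1) \<partial>M2)"
    using Fubini_integral[OF int] by simp
  also have "\<dots> = (\<integral>y. (\<integral>s. E s y * h s * v y \<partial>M1) \<partial>M2)"
    by (simp add: mult_ac)
  finally show ?thesis
    by simp
qed

lemma (in pair_sigma_finite) bounded_kernel_transform:
  fixes E :: "'a \<Rightarrow> 'b \<Rightarrow> complex"
  assumes E: "(\<lambda>(s, y). E s y) \<in> borel_measurable (M1 \<Otimes>\<^sub>M M2)"
    and E_le: "\<And>s y. cmod (E s y) \<le> 1"
    and h: "integrable M1 h"
  shows "(\<lambda>y. \<integral>s. E s y * h s \<partial>M1) \<in> borel_measurable M2"
    and "cmod (\<integral>s. E s y * h s \<partial>M1) \<le> (\<integral>s. cmod (h s) \<partial>M1)"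
proof -
  have [measurable]: "h \<in> borel_measurable M1"
    using h by auto
  note E[measurable]
  show "(\<lambda>y. \<integral>s. E s y * h s \<partial>M1) \<in> borel_measurable M2"
    by measurable
  show "cmod (\<integral>s. E s y * h s \<partial>M1) \<le> (\<integral>s. cmod (h s) \<partial>M1)"
    by (rule order_trans[OF integral_norm_bound], rule integral_mono')
       (use h E_le in \<open>auto simp: norm_mult intro!: mult_left_le_one_le\<close>)
qed

lemma measurable_kernel_cnj:
  assumes "(\<lambda>(s, y). E s y) \<in> borel_measurable M"
  shows "(\<lambda>(s, y). cnj (E s y)) \<in> borel_measurable M"
  using borel_measurable_continuous_on[OF continuous_on_cnj[OF continuous_on_id] assms]
  by (simp add: case_prod_beta)

text \<open>
  The identity \<open>integral_bounded_kernel_swap\<close> is used twice: at fixed \<open>t\<close> it moves the integral over \<open>s\<close>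
  inside, which produces the transform of \<open>g\<close>, and then it moves the integral over \<open>t\<close> inside,
  which produces the conjugate transform. The weight has to be real for the outcome to be real.
\<close>

lemma (in pair_sigma_finite) quadratic_form_factorization:
  fixes E :: "'a \<Rightarrow> 'b \<Rightarrow> complex" and w :: "'b \<Rightarrow> real"
  assumes E: "(\<lambda>(s, y). E s y) \<in> borel_measurable (M1 \<Otimes>\<^sub>M M2)"
    and E_le: "\<And>s y. cmod (E s y) \<le> 1"
    and g: "integrable M1 g" and w: "integrable M2 w"
  shows "(\<integral>t. (\<integral>s. (\<integral>y. E t y * cnj (E s y) * w y \<partial>M2) * g s \<partial>M1) * cnj (g t) \<partial>M1)
       = complex_of_real (\<integral>y. w y * (cmod (\<integral>s. cnj (E s y) * g s \<partial>M1))\<^sup>2 \<partial>M2)"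
proof -
  define F where "F y = (\<integral>s. cnj (E s y) * g s \<partial>M1)" for y
  note E[measurable]
  have cE: "(\<lambda>(s, y). cnj (E s y)) \<in> borel_measurable (M1 \<Otimes>\<^sub>M M2)"
    by (rule measurable_kernel_cnj[OF E])
  have cE_le: "cmod (cnj (E s y)) \<le> 1" for s y
    using E_le by simp
  have F_meas[measurable]: "F \<in> borel_measurable M2"
    unfolding F_def by (rule bounded_kernel_transform(1)[OF cE cE_le g])
  have F_le: "cmod (F y) \<le> (\<integral>s. cmod (g s) \<partial>M1)" for y
    unfolding F_def by (rule bounded_kernel_transform(2)[OF cE cE_le g])
  have cnj_F: "cnj (F y) = (\<integral>t. E t y * cnj (g t) \<partial>M1)" for y
    unfolding F_def Bochner_Integration.integral_cnj[symmetric] by (simp del: Bochner_Integration.integral_cnj)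
  have [measurable]: "w \<in> borel_measurable M2"
    using w by auto
  have Ew: "integrable M2 (\<lambda>y. E t y * w y)" if "t \<in> space M1" for t
  proof (rule Bochner_Integration.integrable_bound[OF w])
    show "(\<lambda>y. E t y * w y) \<in> borel_measurable M2"
      using that by measurable
  qed (use E_le in \<open>auto intro!: AE_I2 mult_left_le_one_le simp: norm_mult\<close>)
  have wF: "integrable M2 (\<lambda>y. w y * F y)"
  proof (rule Bochner_Integration.integrable_bound)
    show "integrable M2 (\<lambda>y. w y * (\<integral>s. cmod (g s) \<partial>M1))"
      using w by simp
  qed (use F_le in \<open>auto intro!: AE_I2 mult_left_mono simp: norm_mult abs_mult\<close>)
  have inner: "(\<integral>s. (\<integral>y. E t y * cnj (E s y) * w y \<partial>M2) * g s \<partial>M1) = (\<integral>y. E t y * (w y * F y) \<partial>M2)"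
    if "t \<in> space M1" for t
    using integral_bounded_kernel_swap[OF cE cE_le g Ew[OF that]]
    by (simp add: F_def mult_ac)
  have "(\<integral>t. (\<integral>s. (\<integral>y. E t y * cnj (E s y) * w y \<partial>M2) * g s \<partial>M1) * cnj (g t) \<partial>M1)
      = (\<integral>t. (\<integral>y. E t y * (w y * F y) \<partial>M2) * cnj (g t) \<partial>M1)"
    by (intro Bochner_Integration.integral_cong refl) (simp add: inner)
  also have "\<dots> = (\<integral>y. (\<integral>t. E t y * cnj (g t) \<partial>M1) * (w y * F y) \<partial>M2)"
    using g by (intro integral_bounded_kernel_swap[OF E E_le _ wF]) simp
  also have "\<dots> = (\<integral>y. cnj (F y) * (w y * F y) \<partial>M2)"
    by (simp add: cnj_F)
  also have "\<dots> = (\<integral>y. complex_of_real (w y * (cmod (F y))\<^sup>2) \<partial>M2)"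
    by (intro Bochner_Integration.integral_cong refl) (simp add: complex_norm_square mult_ac del: of_real_power)
  finally show ?thesis
    by (simp add: F_def flip: integral_complex_of_real)
qed

section \<open>The near field operator\<close>

lemma L2_imp_integrable:
  assumes "finite_measure (lebesgue_on A)" and u: "u \<in> L2 A"
  shows "integrable (lebesgue_on A) (u :: _ \<Rightarrow> complex)"
proof -
  interpret finite_measure "lebesgue_on A" by fact
  have le: "norm (u x) \<le> norm (1 + (norm (u x))\<^sup>2)" for x
    using sum_squares_bound[of 1 "norm (u x)"] norm_ge_zero[of "u x"]
    by (simp add: power2_eq_square del: norm_ge_zero)
  show ?thesis
    by (rule Bochner_Integration.integrable_bound[where f = "\<lambda>x. 1 + (norm (u x))\<^sup>2"])
       (use u le in \<open>auto simp: L2_def\<close>)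
qed

text \<open>
  Conjugating the integrand at \<open>- k\<close> turns \<open>exp (- \<i> * k * d)\<close> into \<open>exp (\<i> * k * d)\<close> and fixes
  the real factor \<open>f y / (4 * pi * d)\<close>.
\<close>

lemma us_eq_radiated_field: "us D f x k = radiated_field D f x k"
proof -
  have "cnj (radiated_field D f x (- k)) = radiated_field D f x k"
    unfolding radiated_field_def Bochner_Integration.integral_cnj[symmetric]
    by (simp add: exp_cnj del: Bochner_Integration.integral_cnj)
  then show ?thesis
    by (simp add: us_def)
qed

text \<open>
  The second claim is needed next to the identity because the integral of a non-integrable
  function is 0, which would make the norm of \<open>P_adj K x g\<close> meaningless. It holds because
  \<open>P_adj K x g\<close> is bounded by the \<open>L\<^sup>1\<close> norm of \<open>g\<close> and \<open>D\<close> has finite measure.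
\<close>

lemma near_field_quadratic_form:
  assumes D: "finite_measure (lebesgue_on D)" and K: "finite_measure (lebesgue_on K)"
    and g: "g \<in> L2 K"
    and w: "integrable (lebesgue_on D) (\<lambda>y. f y / (4 * pi * norm (x - y)))"
  shows "L2_inner K (near_field_op D f K x g) g
       = complex_of_real (\<integral>y. f y / (4 * pi * norm (x - y)) * (cmod (P_adj K x g y))\<^sup>2 \<partial>lebesgue_on D)"
    and "integrable (lebesgue_on D) (\<lambda>y. (cmod (P_adj K x g y))\<^sup>2)"
proof -
  interpret D: finite_measure "lebesgue_on D" by fact
  interpret K: finite_measure "lebesgue_on K" by fact
  interpret pair_sigma_finite "lebesgue_on K" "lebesgue_on D" ..
  define E where "E s y = exp (\<i> * complex_of_real (s * norm (x - y)))" for s :: real and y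
  have id_meas[measurable]: "(\<lambda>z. z) \<in> borel_measurable (lebesgue_on A)" for A :: "'b::euclidean_space set"
    by (rule measurable_restrict_space1) (simp add: measurable_completion)
  have E: "(\<lambda>(s, y). E s y) \<in> borel_measurable (lebesgue_on K \<Otimes>\<^sub>M lebesgue_on D)"
    unfolding E_def by measurable
  have E_le: "cmod (E s y) \<le> 1" for s y
    unfolding E_def by (simp add: norm_exp_i_times del: of_real_mult)
  have cE: "(\<lambda>(s, y). cnj (E s y)) \<in> borel_measurable (lebesgue_on K \<Otimes>\<^sub>M lebesgue_on D)"
    by (rule measurable_kernel_cnj[OF E])
  have g1: "integrable (lebesgue_on K) g"
    by (rule L2_imp_integrable[OF K g])
  have P: "P_adj K x g y = (\<integral>s. cnj (E s y) * g s \<partial>lebesgue_on K)" for y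
    by (simp add: P_adj_def E_def exp_cnj)
  have N: "near_field_op D f K x g t
      = (\<integral>s. (\<integral>y. E t y * cnj (E s y) * complex_of_real (f y / (4 * pi * norm (x - y))) \<partial>lebesgue_on D) * g s \<partial>lebesgue_on K)" for t
  proof -
    have "exp (\<i> * complex_of_real ((t - s) * norm (x - y))) = E t y * cnj (E s y)" for s y
      by (simp add: E_def exp_cnj algebra_simps flip: exp_add)
    then show ?thesis
      by (simp add: near_field_op_def us_eq_radiated_field radiated_field_def)
  qed
  show "L2_inner K (near_field_op D f K x g) g
       = complex_of_real (\<integral>y. f y / (4 * pi * norm (x - y)) * (cmod (P_adj K x g y))\<^sup>2 \<partial>lebesgue_on D)"
    unfolding L2_inner_def N P by (rule quadratic_form_factorization[OF E E_le g1 w])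
  have P_meas[measurable]: "P_adj K x g \<in> borel_measurable (lebesgue_on D)"
    unfolding P[abs_def] using E_le by (intro bounded_kernel_transform(1)[OF cE _ g1]) simp
  have P_le: "cmod (P_adj K x g y) \<le> (\<integral>s. cmod (g s) \<partial>lebesgue_on K)" for y
    unfolding P using E_le by (intro bounded_kernel_transform(2)[OF cE _ g1]) simp
  show "integrable (lebesgue_on D) (\<lambda>y. (cmod (P_adj K x g y))\<^sup>2)"
  proof (rule D.integrable_const_bound)
    show "AE y in lebesgue_on D. norm ((cmod (P_adj K x g y))\<^sup>2) \<le> (\<integral>s. cmod (g s) \<partial>lebesgue_on K)\<^sup>2"
      using P_le by (auto intro!: AE_I2 power_mono)
  qed measurable
qed

section \<open>Two-sided estimate\<close>

lemma abs_integral_eq_of_one_sign: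
  fixes w q :: "'a \<Rightarrow> real"
  assumes "(\<forall>y\<in>space M. 0 \<le> w y) \<or> (\<forall>y\<in>space M. w y \<le> 0)" "\<And>y. 0 \<le> q y"
  shows "\<bar>\<integral>y. w y * q y \<partial>M\<bar> = (\<integral>y. \<bar>w y\<bar> * q y \<partial>M)"
  using assms(1)
proof
  assume pos: "\<forall>y\<in>space M. 0 \<le> w y"
  have "(\<integral>y. \<bar>w y\<bar> * q y \<partial>M) = (\<integral>y. w y * q y \<partial>M)"
    using pos by (intro Bochner_Integration.integral_cong) auto
  moreover have "0 \<le> (\<integral>y. \<bar>w y\<bar> * q y \<partial>M)"
    using assms(2) by simp
  ultimately show ?thesis by simp
next
  assume neg: "\<forall>y\<in>space M. w y \<le> 0"
  have "(\<integral>y. \<bar>w y\<bar> * q y \<partial>M) = (\<integral>y. - (w y * q y) \<partial>M)"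
    using neg by (intro Bochner_Integration.integral_cong) auto
  moreover have "0 \<le> (\<integral>y. \<bar>w y\<bar> * q y \<partial>M)"
    using assms(2) by simp
  ultimately show ?thesis by simp
qed

lemma distance_bounds:
  fixes x :: "'a::real_normed_vector"
  assumes "bounded D" "y \<in> D"
  shows "(INF y\<in>D. norm (x - y)) \<le> norm (x - y)" "norm (x - y) \<le> (SUP y\<in>D. norm (x - y))"
    and "x \<notin> closure D \<Longrightarrow> 0 < (INF y\<in>D. norm (x - y))"
proof -
  have ne: "D \<noteq> {}" using assms by auto
  have inf: "(INF y\<in>D. norm (x - y)) = infdist x D"
    using ne by (simp add: infdist_def dist_norm)
  show "(INF y\<in>D. norm (x - y)) \<le> norm (x - y)"
    unfolding inf using infdist_le[OF assms(2), of x] by (simp add: dist_norm)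
  obtain B where "\<And>z. z \<in> D \<Longrightarrow> norm (x - z) \<le> B"
    using assms(1) bounded_any_center[of D x] by (auto simp: dist_norm)
  then have "bdd_above ((\<lambda>y. norm (x - y)) ` D)"
    by (rule bdd_aboveI2)
  then show "norm (x - y) \<le> (SUP y\<in>D. norm (x - y))"
    by (rule cSUP_upper[OF assms(2)])
  show "0 < (INF y\<in>D. norm (x - y))" if "x \<notin> closure D"
    unfolding inf using in_closure_iff_infdist_zero[OF ne, of x] that infdist_nonneg[of x D] by linarith
qed

theorem theorem4p2:
  fixes D \<Gamma> :: "(real ^ 3) set"
    and f :: "real ^ 3 \<Rightarrow> real"
    and k_max c_f C_f :: real
    and K :: "real set"
  defines "K \<equiv> {0<..k_max}"
  assumes "bounded_lipschitz_domain D"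
    and "connected (- closure D)"
    and "0 < k_max"
    and "finite \<Gamma>" and "\<Gamma> \<subseteq> - closure D"
    and "f \<in> L2 UNIV"
    and "closure {y. f y \<noteq> 0} = closure D"
    and "0 < c_f" and "c_f < C_f"
    and "(\<forall>y\<in>D. c_f \<le> f y \<and> f y \<le> C_f) \<or> (\<forall>y\<in>D. - C_f \<le> f y \<and> f y \<le> - c_f)"
  shows "\<forall>x\<in>\<Gamma>.
    let r\<^sub>1 = (INF y\<in>D. norm (x - y));
        r\<^sub>2 = (SUP y\<in>D. norm (x - y))
    in \<forall>g \<in> (L2 K :: (real \<Rightarrow> complex) set).
         c_f / (4 * pi * r\<^sub>2) * (L2_norm D (P_adj K x g))\<^sup>2
           \<le> cmod (L2_inner K (near_field_op D f K x g) g) \<and>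
         cmod (L2_inner K (near_field_op D f K x g) g)
           \<le> C_f / (4 * pi * r\<^sub>1) * (L2_norm D (P_adj K x g))\<^sup>2"
proof -
  have bD: "bounded D" and oD: "open D"
    using assms(2) by (auto simp: bounded_lipschitz_domain_def)
  have D: "D \<in> lmeasurable"
    using bD oD by (rule lmeasurable_open)
  have fin_D: "finite_measure (lebesgue_on D)"
    using D by (rule finite_measure_lebesgue_on)
  have fin_K: "finite_measure (lebesgue_on K)"
    by (rule finite_measure_lebesgue_on) (simp add: K_def bounded_set_imp_lmeasurable)
  interpret D: finite_measure "lebesgue_on D" by (rule fin_D)
  have space_D: "space (lebesgue_on D) = D"
    using D by (simp add: space_restrict_space)
  have "c_f / (4 * pi * (SUP y\<in>D. norm (x - y))) * (L2_norm D (P_adj K x g))\<^sup>2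
           \<le> cmod (L2_inner K (near_field_op D f K x g) g) \<and>
         cmod (L2_inner K (near_field_op D f K x g) g)
           \<le> C_f / (4 * pi * (INF y\<in>D. norm (x - y))) * (L2_norm D (P_adj K x g))\<^sup>2"
    if x: "x \<in> \<Gamma>" and g: "g \<in> L2 K" for x and g :: "real \<Rightarrow> complex"
  proof -
    define r1 where "r1 = (INF y\<in>D. norm (x - y))"
    define r2 where "r2 = (SUP y\<in>D. norm (x - y))"
    define w where "w y = f y / (4 * pi * norm (x - y))" for y
    define q where "q y = (cmod (P_adj K x g y))\<^sup>2" for y
    have x_out: "x \<notin> closure D"
      using x assms(6) by auto
    have r: "0 < r1" "r1 \<le> norm (x - y)" "norm (x - y) \<le> r2" if "y \<in> D" for y
      using distance_bounds[OF bD that, of x] x_out by (auto simp: r1_def r2_def)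
    have w_bounds: "c_f / (4 * pi * r2) \<le> \<bar>w y\<bar>" "\<bar>w y\<bar> \<le> C_f / (4 * pi * r1)" if y: "y \<in> D" for y
    proof -
      have fy: "c_f \<le> \<bar>f y\<bar>" "\<bar>f y\<bar> \<le> C_f"
        using assms(9,11) y by (auto simp: abs_if)
      have w_abs: "\<bar>w y\<bar> = \<bar>f y\<bar> / (4 * pi * norm (x - y))"
        by (simp add: w_def abs_mult)
      show "c_f / (4 * pi * r2) \<le> \<bar>w y\<bar>" "\<bar>w y\<bar> \<le> C_f / (4 * pi * r1)"
        unfolding w_abs using fy r[OF y] assms(9) by (auto intro!: frac_le mult_left_mono mult_pos_pos)
    qed
    have f_meas[measurable]: "f \<in> borel_measurable (lebesgue_on D)"
      using assms(7) by (auto simp: L2_def intro: measurable_restrict_space1)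
    have d_meas[measurable]: "(\<lambda>y. norm (x - y)) \<in> borel_measurable (lebesgue_on D)"
      by (rule measurable_restrict_space1) (simp add: measurable_completion)
    have w_int: "integrable (lebesgue_on D) w"
    proof (rule D.integrable_const_bound)
      show "AE y in lebesgue_on D. norm (w y) \<le> C_f / (4 * pi * r1)"
        using w_bounds by (intro AE_I2) (simp add: space_D)
    qed (unfold w_def[abs_def], measurable)
    have form: "L2_inner K (near_field_op D f K x g) g = complex_of_real (\<integral>y. w y * q y \<partial>lebesgue_on D)"
      and q_int: "integrable (lebesgue_on D) q"
      using near_field_quadratic_form[OF fin_D fin_K g w_int[unfolded w_def]]
      by (simp_all add: w_def q_def[abs_def])
    have P_norm: "(L2_norm D (P_adj K x g))\<^sup>2 = (\<integral>y. q y \<partial>lebesgue_on D)"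
      by (simp add: L2_norm_def q_def)
    have q_nonneg: "0 \<le> q y" for y
      by (simp add: q_def)
    have "(\<forall>y\<in>D. 0 \<le> f y) \<or> (\<forall>y\<in>D. f y \<le> 0)"
      using assms(9,11) by force
    then have sgn: "(\<forall>y\<in>space (lebesgue_on D). 0 \<le> w y) \<or> (\<forall>y\<in>space (lebesgue_on D). w y \<le> 0)"
      unfolding space_D w_def by (auto intro!: divide_nonneg_nonneg divide_nonpos_nonneg)
    have abs_form: "cmod (L2_inner K (near_field_op D f K x g) g) = (\<integral>y. \<bar>w y\<bar> * q y \<partial>lebesgue_on D)"
      unfolding form norm_of_real by (rule abs_integral_eq_of_one_sign[OF sgn q_nonneg])
    have wq_int: "integrable (lebesgue_on D) (\<lambda>y. \<bar>w y\<bar> * q y)"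
    proof (rule Bochner_Integration.integrable_bound)
      show "integrable (lebesgue_on D) (\<lambda>y. C_f / (4 * pi * r1) * q y)"
        using q_int by simp
      show "AE y in lebesgue_on D. norm (\<bar>w y\<bar> * q y) \<le> norm (C_f / (4 * pi * r1) * q y)"
      proof (rule AE_I2)
        fix y assume "y \<in> space (lebesgue_on D)"
        then have "\<bar>w y\<bar> * q y \<le> C_f / (4 * pi * r1) * q y"
          using w_bounds(2) q_nonneg by (intro mult_right_mono) (auto simp: space_D)
        moreover have "norm (\<bar>w y\<bar> * q y) = \<bar>w y\<bar> * q y"
          using q_nonneg[of y] by (simp add: abs_mult)
        ultimately show "norm (\<bar>w y\<bar> * q y) \<le> norm (C_f / (4 * pi * r1) * q y)"
          using abs_ge_self[of "C_f / (4 * pi * r1) * q y"] unfolding real_norm_def by linarith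
      qed
    qed (use w_int q_int in auto)
    have "(\<integral>y. c_f / (4 * pi * r2) * q y \<partial>lebesgue_on D) \<le> (\<integral>y. \<bar>w y\<bar> * q y \<partial>lebesgue_on D)"
      using w_bounds(1) q_nonneg q_int wq_int
      by (intro integral_mono mult_right_mono) (auto simp: space_D)
    moreover have "(\<integral>y. \<bar>w y\<bar> * q y \<partial>lebesgue_on D) \<le> (\<integral>y. C_f / (4 * pi * r1) * q y \<partial>lebesgue_on D)"
      using w_bounds(2) q_nonneg q_int wq_int
      by (intro integral_mono mult_right_mono) (auto simp: space_D)
    ultimately show ?thesis
      unfolding abs_form P_norm r1_def[symmetric] r2_def[symmetric] by simp
  qed
  then show ?thesis
    unfolding Let_def by blast
qed

end
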